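(* For every $n\ge1$, the total number of interior points $\sum_{w\in\mathcal{M}_n}\mathrm{inter}(w)$ over all Motzkin polyominoes of length $n$ is $$\frac{1}{2}\left(3^n-3T_n\right)-2T_{n-1}+2m_{n-1},$$ where $T_n$ is the $n$-th central trinomial coefficient and $m_n$ is the $n$-th Motzkin number.
   Context: A Motzkin word of length $n\ge 1$ is a word $w=w_1\cdots w_n$ over the positive integers such that $w_1=1$, and $1\le w_k\le w_{k-1}+1$ and $w_{k-1}\ne w_k$ for $k=2,\dots,n$; $\mathcal{M}_n$ is the set of Motzkin words of length $n$. To $w$ one associates the Motzkin polyomino $P(w)$ of length $n$ with $n$ columns, all bottom-justified, whose $i$-th column consists of $w_i$ unit cells. An interior point of $P(w)$ is a point that belongs to exactly four cells of $P(w)$, and $\mathrm{inter}(w)$ is the number of interior points of $P(w)$. The central trinomial coefficient $T_n$ ($n\ge0$) is the coefficient of $x^n$ in $(1+x+x^2)^n$. The Motzkin numbers $m_n$ are defined by $\sum_{n\ge0}m_nx^n=\frac{1-x-\sqrt{1-2x-3x^2}}{2x^2}$. *)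

theory Defs
  imports "HOL-Computational_Algebra.Computational_Algebra"
begin

text \<open>Words are lists, so the letter \<open>w\<^sub>k\<close> is \<open>w ! (k - 1)\<close>.
  The condition \<open>1 \<le> n\<close> makes the set empty for \<open>n = 0\<close>, where no Motzkin words are defined.\<close>

definition motzkin_words :: "nat \<Rightarrow> nat list set" where
  "motzkin_words n = {w. 1 \<le> n \<and> length w = n \<and> w ! 0 = 1 \<and>
     (\<forall>k\<in>{2..n}. 1 \<le> w ! (k - 1) \<and> w ! (k - 1) \<le> w ! (k - 2) + 1 \<and> w ! (k - 2) \<noteq> w ! (k - 1))}"

definition unit_cell :: "nat \<Rightarrow> nat \<Rightarrow> (real \<times> real) set" where
  "unit_cell i j = {real i - 1..real i} \<times> {real j - 1..real j}"

text \<open>A polyomino is represented by its set of cells, each of them a closed unit square.\<close>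

definition motzkin_polyomino :: "nat list \<Rightarrow> (real \<times> real) set set" where
  "motzkin_polyomino w = {unit_cell i j | i j. i \<in> {1..length w} \<and> j \<in> {1..w ! (i - 1)}}"

definition interior_points :: "(real \<times> real) set set \<Rightarrow> (real \<times> real) set" where
  "interior_points P = {p. card {C \<in> P. p \<in> C} = 4}"

definition inter_count :: "nat list \<Rightarrow> nat" where
  "inter_count w = card (interior_points (motzkin_polyomino w))"

definition central_trinomial :: "nat \<Rightarrow> int" where
  "central_trinomial n = coeff ([:1, 1, 1:] ^ n) n"

text \<open>The square root is the formal power series with constant coefficient \<open>root 2 1 = 1\<close>.
  The numerator is divisible by \<open>fps_X\<^sup>2\<close>, so the division is exact
  (see \<open>motzkin_fps_mult\<close> below).\<close>

definition motzkin_fps :: "real fps" where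
  "motzkin_fps =
     (1 - fps_X - fps_radical root 2 (1 - 2 * fps_X - 3 * fps_X ^ 2)) / (2 * fps_X ^ 2)"

definition motzkin_number :: "nat \<Rightarrow> real" where
  "motzkin_number n = fps_nth motzkin_fps n"

lemma fps_sqrt_power2:
  "fps_radical root 2 (1 - 2 * fps_X - 3 * fps_X ^ 2 :: real fps) ^ 2 =
     1 - 2 * fps_X - 3 * fps_X ^ 2"
  using power_radical[of "1 - 2 * fps_X - 3 * fps_X ^ 2 :: real fps" root 1]
  by (simp add: numeral_2_eq_2 fps_X_power_nth)

lemma motzkin_fps_mult:
  "motzkin_fps * (2 * fps_X ^ 2) =
     1 - fps_X - fps_radical root 2 (1 - 2 * fps_X - 3 * fps_X ^ 2)"
proof -
  define S :: "real fps" where "S = fps_radical root 2 (1 - 2 * fps_X - 3 * fps_X ^ 2)"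
  have sq: "S ^ 2 = 1 - 2 * fps_X - 3 * fps_X ^ 2"
    unfolding S_def by (rule fps_sqrt_power2)
  have S0: "fps_nth S 0 = 1"
    by (simp add: S_def)
  have "fps_nth (S ^ 2) 1 = fps_nth (1 - 2 * fps_X - 3 * fps_X ^ 2 :: real fps) 1"
    by (simp add: sq)
  hence S1: "fps_nth S 1 = -1"
    by (simp add: power2_eq_square fps_mult_nth numeral_fps_const S0)
  have "fps_X ^ 2 dvd (1 - fps_X - S)"
  proof (cases "1 - fps_X - S = 0")
    case False
    have "2 \<le> subdegree (1 - fps_X - S)"
      by (rule subdegree_geI) (use False S0 S1 in \<open>auto simp: less_2_cases_iff\<close>)
    with False show ?thesis
      by (simp add: fps_dvd_iff)
  qed simp
  moreover have "is_unit (2 :: real fps)"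
    by simp
  ultimately have "2 * fps_X ^ 2 dvd (1 - fps_X - S)"
    by (simp add: mult_unit_dvd_iff')
  thus ?thesis
    by (simp add: motzkin_fps_def S_def)
qed

lemma finite_motzkin_words: "finite (motzkin_words n)"
proof (rule finite_subset)
  have "w ! k \<le> k + 1" if "w \<in> motzkin_words n" "k < n" for w k
    using that(2)
  proof (induction k)
    case 0
    with that show ?case by (simp add: motzkin_words_def)
  next
    case (Suc k)
    have "Suc (Suc k) \<in> {2..n}" using Suc.prems by simp
    with that(1) have "w ! (Suc (Suc k) - 1) \<le> w ! (Suc (Suc k) - 2) + 1"
      unfolding motzkin_words_def by blast
    with Suc show ?case by simp
  qed
  thus "motzkin_words n \<subseteq> {w. set w \<subseteq> {..n} \<and> length w = n}"
    by (fastforce simp: motzkin_words_def in_set_conv_nth)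
  show "finite {w :: nat list. set w \<subseteq> {..n} \<and> length w = n}"
    by (rule finite_lists_length_eq) simp
qed

end

theory Submission
  imports Defs
begin

text \<open>
  Two neighbouring columns of heights \<open>a\<close> and \<open>b\<close> contribute exactly \<open>min a b - 1\<close> interior points,
  all on the vertical line that separates them. So \<open>inter_count\<close> is a sum over consecutive letters
  (\<open>inter_count_eq_overlap\<close>), and this sum is additive under the first-return decomposition of
  Motzkin words: a word of length at least 2 is uniquely \<open>1 # map Suc u @ v\<close>, where \<open>u\<close> is a
  Motzkin word and \<open>v\<close> is a Motzkin word or empty, the split being at the second letter 1 of the
  word. Raising \<open>u\<close> by one level adds one interior point for each of its \<open>length u - 1\<close> pairs of
  consecutive columns, and the junctions with the two columns of height 1 contribute nothing.

  Let \<open>M\<close> and \<open>I\<close> be the generating functions of the number of words and of their interior points.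
  The decomposition gives (\<open>word_fps_eq\<close>, \<open>inter_fps_eq\<close>)
    \<open>M = x + x M (1 + M)\<close> and \<open>I = x ((I + x M' - M) (1 + M) + M I)\<close>.
  By the quadratic equation, \<open>S = 1 - x - 2 x M\<close> is the square root of
  \<open>1 - 2 x - 3 x\<^sup>2 = (1 - 3 x) (1 + x)\<close>. Differentiating it gives \<open>M' S = 1 + M + M\<^sup>2\<close>, so \<open>M'\<close> can be
  eliminated, and \<open>I S\<^sup>2\<close> is a polynomial in \<open>x\<close> and \<open>M\<close>. The series of the central trinomial
  coefficients is \<open>1 / S\<close> (\<open>trinomial_fps_mult_radical\<close>): their three-term recurrence says that it
  satisfies the same first-order differential equation as \<open>1 / S\<close>. The formula is then an identity
  between polynomials in \<open>x\<close> and \<open>M\<close>, valid modulo the quadratic equation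
  (\<open>inter_fps_closed_form\<close>).
\<close>

section \<open>Interior points\<close>

fun overlap :: "nat list \<Rightarrow> nat" where
  "overlap (a # b # w) = (min a b - 1) + overlap (b # w)"
| "overlap _ = 0"

lemma overlap_conv_sum:
  "overlap w = (\<Sum>i\<in>{1..<length w}. min (w ! (i - 1)) (w ! i) - 1)"
proof (induction w rule: overlap.induct)
  case (1 a b w)
  let ?f = "\<lambda>i. min ((a # b # w) ! (i - 1)) ((a # b # w) ! i) - 1"
  have "(\<Sum>i\<in>{1..<length (a # b # w)}. ?f i) = ?f 1 + (\<Sum>i\<in>{Suc 1..<Suc (length (b # w))}. ?f i)"
    by (subst sum.atLeast_Suc_lessThan) auto
  also have "(\<Sum>i\<in>{Suc 1..<Suc (length (b # w))}. ?f i) = (\<Sum>i\<in>{1..<length (b # w)}. ?f (Suc i))"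
    by (rule sum.shift_bounds_Suc_ivl)
  also have "\<dots> = (\<Sum>i\<in>{1..<length (b # w)}. min ((b # w) ! (i - 1)) ((b # w) ! i) - 1)"
    by (intro sum.cong) (auto simp: nth_Cons split: nat.splits)
  finally show ?case using 1 by simp
qed auto

text \<open>For a point to lie in four cells, two columns and two rows must contain it. A coordinate lies in
  at most two of the unit intervals, and in two only if it is an integer.\<close>

lemma card_unit_intervals:
  fixes x :: real
  defines "K \<equiv> {i::nat. real i - 1 \<le> x \<and> x \<le> real i}"
  shows "finite K \<and> card K \<le> 2 \<and> (card K = 2 \<longrightarrow> (\<exists>m. x = real m \<and> K = {m, Suc m}))"
proof (cases "K = {}")
  case False
  define m where "m = (LEAST i. i \<in> K)"
  have mK: "m \<in> K" and least: "\<And>i. i \<in> K \<Longrightarrow> m \<le> i"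
    unfolding m_def using False by (auto intro: LeastI Least_le)
  have sub: "K \<subseteq> {m, Suc m}"
  proof
    fix i assume "i \<in> K"
    with mK have "real i \<le> real m + 1" unfolding K_def by auto
    with least[OF \<open>i \<in> K\<close>] show "i \<in> {m, Suc m}" by auto
  qed
  have "card K \<le> 2" using card_mono[OF _ sub] by simp
  moreover have "\<exists>m. x = real m \<and> K = {m, Suc m}" if "card K = 2"
  proof -
    have K: "K = {m, Suc m}" using sub that by (intro card_subset_eq) auto
    hence "Suc m \<in> K" by simp
    with mK have "x = real m" unfolding K_def by auto
    with K show ?thesis by blast
  qed
  ultimately show ?thesis using finite_subset[OF sub] by simp
qed simp

lemma unit_intervals_real:
  "{i::nat. real i - 1 \<le> real m \<and> real m \<le> real i} = {m, Suc m}"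
  by auto

lemma inj_unit_cell: "inj (\<lambda>(i, j). unit_cell i j)"
proof (rule injI, clarify)
  fix i j i' j' assume "unit_cell i j = unit_cell i' j'"
  hence "{real i - 1..real i} = {real i' - 1..real i'}" "{real j - 1..real j} = {real j' - 1..real j'}"
    unfolding unit_cell_def by (auto simp: times_eq_iff)
  thus "i = i' \<and> j = j'" by (auto simp: Icc_eq_Icc)
qed

text \<open>The cells that contain \<open>(x, y)\<close> have their column index among at most two values and their row
  index among at most two values. Being in four cells therefore forces both coordinates to be
  integers \<open>i\<close>, \<open>j\<close> and all of the four cells around \<open>(i, j)\<close> to be present; this says that the
  columns \<open>i\<close> and \<open>i + 1\<close> exist and are both higher than \<open>j\<close>.\<close>

lemma interior_points_motzkin_polyomino:
  "interior_points (motzkin_polyomino w) =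
     (\<lambda>(i, j). (real i, real j)) ` (SIGMA i:{1..<length w}. {1..<min (w ! (i - 1)) (w ! i)})"
proof (intro equalityI subsetI)
  fix p assume p: "p \<in> interior_points (motzkin_polyomino w)"
  obtain x y where xy: "p = (x, y)" by fastforce
  define V where "V = (SIGMA i:{1..length w}. {1..w ! (i - 1)})"
  define K where "K = (\<lambda>x::real. {i::nat. real i - 1 \<le> x \<and> x \<le> real i})"
  have "{C \<in> motzkin_polyomino w. p \<in> C} = (\<lambda>(i, j). unit_cell i j) ` (V \<inter> K x \<times> K y)"
    unfolding motzkin_polyomino_def V_def K_def xy by (force simp: unit_cell_def)
  hence four: "card (V \<inter> K x \<times> K y) = 4"
    using p inj_unit_cell by (auto simp: interior_points_def card_image inj_on_subset)
  have fin: "finite (K x \<times> K y)" and le: "card (K x) \<le> 2" "card (K y) \<le> 2"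
    using card_unit_intervals[of x] card_unit_intervals[of y] by (auto simp: K_def)
  \<comment> \<open>Four index pairs inside a product of two sets of size at most 2 fill the whole product.\<close>
  have "4 \<le> card (K x) * card (K y)"
    using card_mono[OF fin, of "V \<inter> K x \<times> K y"] four by (simp add: card_cartesian_product)
  moreover have "card (K x) * card (K y) \<le> 2 * card (K y)" "card (K x) * card (K y) \<le> card (K x) * 2"
    using le by auto
  ultimately have two: "card (K x) = 2" "card (K y) = 2" using le by linarith+
  then obtain i j where ij: "x = real i" "K x = {i, Suc i}" "y = real j" "K y = {j, Suc j}"
    using card_unit_intervals[of x] card_unit_intervals[of y] by (auto simp: K_def)
  have "V \<inter> K x \<times> K y = K x \<times> K y"
    using four two by (intro card_subset_eq fin) (auto simp: card_cartesian_product)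
  hence "{i, Suc i} \<times> {j, Suc j} \<subseteq> V" using ij by auto
  hence "(i, j) \<in> (SIGMA i:{1..<length w}. {1..<min (w ! (i - 1)) (w ! i)})"
    by (auto simp: V_def)
  thus "p \<in> (\<lambda>(i, j). (real i, real j)) ` (SIGMA i:{1..<length w}. {1..<min (w ! (i - 1)) (w ! i)})"
    unfolding xy ij by force
next
  fix p assume "p \<in> (\<lambda>(i, j). (real i, real j)) ` (SIGMA i:{1..<length w}. {1..<min (w ! (i - 1)) (w ! i)})"
  then obtain i j where p: "p = (real i, real j)"
    and ij: "1 \<le> i" "i < length w" "1 \<le> j" "j < w ! (i - 1)" "j < w ! i" by auto
  have "{C \<in> motzkin_polyomino w. p \<in> C} = (\<lambda>(i, j). unit_cell i j) ` ({i, Suc i} \<times> {j, Suc j})"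
  proof (intro equalityI subsetI)
    fix C assume "C \<in> {C \<in> motzkin_polyomino w. p \<in> C}"
    then obtain k l where "C = unit_cell k l" "real k - 1 \<le> real i" "real i \<le> real k"
        "real l - 1 \<le> real j" "real j \<le> real l"
      unfolding motzkin_polyomino_def p by (auto simp: unit_cell_def)
    with unit_intervals_real[of i] unit_intervals_real[of j]
    show "C \<in> (\<lambda>(i, j). unit_cell i j) ` ({i, Suc i} \<times> {j, Suc j})" by blast
  next
    fix C assume "C \<in> (\<lambda>(i, j). unit_cell i j) ` ({i, Suc i} \<times> {j, Suc j})"
    then obtain k l where kl: "C = unit_cell k l" "k \<in> {i, Suc i}" "l \<in> {j, Suc j}" by auto
    hence "k \<in> {1..length w}" "l \<in> {1..w ! (k - 1)}" "p \<in> C"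
      using ij by (auto simp: p unit_cell_def)
    with kl(1) show "C \<in> {C \<in> motzkin_polyomino w. p \<in> C}"
      unfolding motzkin_polyomino_def by blast
  qed
  moreover have "card ({i, Suc i} \<times> {j, Suc j}) = 4" by (simp add: card_cartesian_product)
  ultimately have "card {C \<in> motzkin_polyomino w. p \<in> C} = 4"
    using card_image[OF inj_on_subset[OF inj_unit_cell subset_UNIV]] by metis
  thus "p \<in> interior_points (motzkin_polyomino w)" by (simp add: interior_points_def)
qed

lemma inter_count_eq_overlap: "inter_count w = overlap w"
proof -
  have "inter_count w = card (SIGMA i:{1..<length w}. {1..<min (w ! (i - 1)) (w ! i)})"
    unfolding inter_count_def interior_points_motzkin_polyomino
    by (rule card_image) (auto simp: inj_on_def)
  also have "\<dots> = overlap w" by (simp add: overlap_conv_sum card_SigmaI)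
  finally show ?thesis .
qed

lemma overlap_append:
  "u \<noteq> [] \<Longrightarrow> v \<noteq> [] \<Longrightarrow> overlap (u @ v) = overlap u + (min (last u) (hd v) - 1) + overlap v"
proof (induction u rule: overlap.induct)
  case ("2_2" a)
  then show ?case by (cases v) auto
qed auto

lemma overlap_map_Suc:
  "\<forall>a\<in>set u. 1 \<le> a \<Longrightarrow> overlap (map Suc u) = overlap u + (length u - 1)"
  by (induction u rule: overlap.induct) auto

section \<open>First-return decomposition\<close>

definition motzkin_step :: "nat \<Rightarrow> nat \<Rightarrow> bool" where
  "motzkin_step a b \<longleftrightarrow> 1 \<le> b \<and> b \<le> a + 1 \<and> a \<noteq> b"

text \<open>The condition on consecutive letters in the form of \<open>successively\<close>, which splits over
  concatenation; this is what the decomposition below needs.\<close>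

lemma mem_motzkin_words_iff:
  "w \<in> motzkin_words n \<longleftrightarrow> length w = n \<and> w \<noteq> [] \<and> hd w = 1 \<and> successively motzkin_step w"
proof -
  have "(\<forall>k\<in>{2..n}. 1 \<le> w ! (k - 1) \<and> w ! (k - 1) \<le> w ! (k - 2) + 1 \<and> w ! (k - 2) \<noteq> w ! (k - 1)) \<longleftrightarrow>
        (\<forall>i. Suc i < n \<longrightarrow> motzkin_step (w ! i) (w ! Suc i))" (is "?L \<longleftrightarrow> ?R")
  proof
    assume L: ?L
    show ?R
    proof (intro allI impI)
      fix i assume "Suc i < n"
      hence "Suc (Suc i) \<in> {2..n}" by simp
      from bspec[OF L this] show "motzkin_step (w ! i) (w ! Suc i)" by (simp add: motzkin_step_def)
    qed
  next
    assume R: ?R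
    show ?L
    proof
      fix k assume "k \<in> {2..n}"
      hence "k = Suc (Suc (k - 2))" "Suc (k - 2) < n" by auto
      then obtain i where "k = Suc (Suc i)" "Suc i < n" by blast
      with R show "1 \<le> w ! (k - 1) \<and> w ! (k - 1) \<le> w ! (k - 2) + 1 \<and> w ! (k - 2) \<noteq> w ! (k - 1)"
        by (simp add: motzkin_step_def)
    qed
  qed
  thus ?thesis
    by (cases w) (auto simp: motzkin_words_def successively_conv_nth)
qed

lemma motzkin_words_0: "motzkin_words 0 = {}"
  by (simp add: motzkin_words_def)

lemma motzkin_word_pos: "w \<in> motzkin_words n \<Longrightarrow> a \<in> set w \<Longrightarrow> 1 \<le> a"
proof -
  have "successively motzkin_step w \<Longrightarrow> 1 \<le> hd w \<Longrightarrow> a \<in> set w \<Longrightarrow> 1 \<le> a" for w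
    by (induction w rule: induct_list012) (auto simp: motzkin_step_def)
  thus "w \<in> motzkin_words n \<Longrightarrow> a \<in> set w \<Longrightarrow> 1 \<le> a" by (auto simp: mem_motzkin_words_iff)
qed

text \<open>The possible final parts of a decomposed word: the empty word is admitted here, so that the
  generating function is \<open>1 + M\<close>.\<close>

definition motzkin_words' :: "nat \<Rightarrow> nat list set" where
  "motzkin_words' n = (if n = 0 then {[]} else motzkin_words n)"

definition join_words :: "nat list \<times> nat list \<Rightarrow> nat list" where
  "join_words = (\<lambda>(u, v). 1 # map Suc u @ v)"

text \<open>The two junctions are legal steps: from 1 up to the first letter 2 of the raised word, and from
  its last letter, which is at least 2, down to 1.\<close>

lemma join_words_mem:
  assumes u: "u \<in> motzkin_words a" and v: "v \<in> motzkin_words' b"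
  shows "join_words (u, v) \<in> motzkin_words (Suc (a + b))"
proof -
  have "successively motzkin_step (map Suc u)"
    using u by (auto simp: mem_motzkin_words_iff successively_map motzkin_step_def
        elim: successively_mono)
  moreover have "motzkin_step 1 (hd (map Suc u))" "u \<noteq> []"
    using u by (auto simp: mem_motzkin_words_iff motzkin_step_def hd_map)
  moreover have "motzkin_step (last (map Suc u)) (hd v)" if "v \<noteq> []"
    using u v that motzkin_word_pos[OF u, of "last u"]
    by (auto simp: mem_motzkin_words_iff motzkin_words'_def motzkin_step_def last_map split: if_splits)
  moreover have "successively motzkin_step v" "length v = b"
    using v by (auto simp: motzkin_words'_def mem_motzkin_words_iff split: if_splits)
  moreover have "length u = a" using u by (simp add: mem_motzkin_words_iff)
  ultimately show ?thesis
    by (auto simp: mem_motzkin_words_iff join_words_def successively_Cons successively_append_iff)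
qed

text \<open>The first part is recovered as the longest prefix of letters at least 2, because the second part
  is empty or begins with 1.\<close>

lemma join_words_inj:
  assumes "u \<in> motzkin_words a" "u' \<in> motzkin_words a'" "v \<in> motzkin_words' b" "v' \<in> motzkin_words' b'"
    and "join_words (u, v) = join_words (u', v')"
  shows "u = u' \<and> v = v'"
proof -
  have tw: "takeWhile (\<lambda>x. 2 \<le> x) (map Suc u @ v) = map Suc u"
    if "u \<in> motzkin_words a" "v \<in> motzkin_words' b" for u v a b
  proof -
    have "\<forall>x\<in>set (map Suc u). 2 \<le> x" using motzkin_word_pos[OF that(1)] by fastforce
    moreover have "takeWhile (\<lambda>x. 2 \<le> x) v = []"
      using that(2) by (cases v) (auto simp: motzkin_words'_def mem_motzkin_words_iff split: if_splits)
    ultimately show ?thesis by (subst takeWhile_append2) auto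
  qed
  have eq: "map Suc u @ v = map Suc u' @ v'" using assms(5) by (simp add: join_words_def)
  have "map Suc u = map Suc u'" using tw[OF assms(1,3)] tw[OF assms(2,4)] eq by metis
  with eq show ?thesis by (simp add: inj_map_eq_map)
qed

text \<open>Since the second letter of a word is always 2, the maximal block of letters at least 2 after
  the initial 1 is a nonempty Motzkin word raised by one. The first letter below 2 is 1, so the
  rest is again a Motzkin word.\<close>

lemma motzkin_word_split:
  assumes w: "w \<in> motzkin_words (Suc n)" and n: "n > 0"
  obtains a u v where "a \<le> n" "u \<in> motzkin_words a" "v \<in> motzkin_words' (n - a)" "w = join_words (u, v)"
proof -
  from w obtain w' where w': "w = 1 # w'" by (cases w) (auto simp: mem_motzkin_words_iff)
  define u' where "u' = takeWhile (\<lambda>x. 2 \<le> x) w'"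
  define v where "v = dropWhile (\<lambda>x. 2 \<le> x) w'"
  have w'_uv: "w' = u' @ v" by (simp add: u'_def v_def)
  have len: "length w' = n" "w' \<noteq> []" using w w' n by (auto simp: mem_motzkin_words_iff)
  have succ: "successively motzkin_step (1 # w')" using w w' by (simp add: mem_motzkin_words_iff)
  hence hd': "hd w' = 2" using len by (auto simp: successively_Cons motzkin_step_def)
  hence ne: "u' \<noteq> []" "hd u' = 2" using len by (cases w'; auto simp: u'_def)+
  define u where "u = map (\<lambda>x. x - 1) u'"
  have ge2: "\<forall>x\<in>set u'. 2 \<le> x" by (auto simp: u'_def dest: set_takeWhileD)
  hence u': "u' = map Suc u" unfolding u_def by (auto intro!: map_idI[symmetric])
  have succ2: "successively motzkin_step u'" "successively motzkin_step v"
    using succ w'_uv by (auto simp: successively_Cons successively_append_iff)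
  have "successively motzkin_step u"
    unfolding u_def successively_map
    by (rule successively_mono[OF succ2(1)]) (use ge2 in \<open>fastforce simp: motzkin_step_def\<close>)
  hence "u \<in> motzkin_words (length u)"
    using ne u_def by (auto simp: mem_motzkin_words_iff hd_map)
  moreover have "v \<in> motzkin_words' (n - length u)"
  proof (cases "v = []")
    case True
    thus ?thesis using len w'_uv u' by (auto simp: motzkin_words'_def)
  next
    case False
    have "\<not> 2 \<le> hd v" using False unfolding v_def by (rule hd_dropWhile)
    moreover have "1 \<le> hd v"
      using motzkin_word_pos[OF w, of "hd v"] False w' w'_uv by auto
    ultimately have "hd v = 1" by simp
    thus ?thesis using len w'_uv u' False succ2
      by (auto simp: motzkin_words'_def mem_motzkin_words_iff)
  qed
  moreover have "w = join_words (u, v)" using w' w'_uv u' by (simp add: join_words_def)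
  moreover have "length u \<le> n" using len w'_uv u' by auto
  ultimately show thesis using that by blast
qed

lemma sum_motzkin_words_Suc:
  fixes f :: "nat list \<Rightarrow> 'a::comm_monoid_add"
  assumes "n > 0"
  shows "(\<Sum>w\<in>motzkin_words (Suc n). f w) =
           (\<Sum>a\<le>n. \<Sum>u\<in>motzkin_words a. \<Sum>v\<in>motzkin_words' (n - a). f (join_words (u, v)))"
proof -
  have fin': "finite (motzkin_words' b)" for b by (simp add: motzkin_words'_def finite_motzkin_words)
  let ?D = "SIGMA a:{..n}. motzkin_words a \<times> motzkin_words' (n - a)"
  have "bij_betw (\<lambda>(a, p). join_words p) ?D (motzkin_words (Suc n))"
  proof (rule bij_betwI')
    fix p q assume "p \<in> ?D" "q \<in> ?D"
    then obtain a u v a' u' v' where pq: "p = (a, u, v)" "q = (a', u', v')"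
      and mem: "u \<in> motzkin_words a" "u' \<in> motzkin_words a'"
               "v \<in> motzkin_words' (n - a)" "v' \<in> motzkin_words' (n - a')" by auto
    have "length u = a" "length u' = a'" using mem by (simp_all add: mem_motzkin_words_iff)
    with join_words_inj[OF mem]
    show "((\<lambda>(a, p). join_words p) p = (\<lambda>(a, p). join_words p) q) \<longleftrightarrow> p = q"
      unfolding pq by auto
  next
    fix p assume "p \<in> ?D"
    then obtain a u v where "p = (a, u, v)" "a \<le> n" "u \<in> motzkin_words a" "v \<in> motzkin_words' (n - a)"
      by auto
    thus "(\<lambda>(a, p). join_words p) p \<in> motzkin_words (Suc n)"
      using join_words_mem[of u a v "n - a"] by simp
  next
    fix w assume "w \<in> motzkin_words (Suc n)"
    then obtain a u v where "a \<le> n" "u \<in> motzkin_words a" "v \<in> motzkin_words' (n - a)" "w = join_words (u, v)"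
      using motzkin_word_split assms by metis
    thus "\<exists>p\<in>?D. w = (\<lambda>(a, p). join_words p) p" by (intro bexI[of _ "(a, u, v)"]) auto
  qed
  hence "(\<Sum>w\<in>motzkin_words (Suc n). f w) = (\<Sum>p\<in>?D. f ((\<lambda>(a, p). join_words p) p))"
    by (rule sum.reindex_bij_betw[symmetric])
  also have "\<dots> = (\<Sum>a\<le>n. \<Sum>p\<in>motzkin_words a \<times> motzkin_words' (n - a). f (join_words p))"
    by (subst sum.Sigma) (auto simp: finite_motzkin_words fin' split_def)
  finally show ?thesis by (simp add: sum.cartesian_product split_def)
qed

lemma motzkin_words_1: "motzkin_words 1 = {[1]}"
  by (auto simp: mem_motzkin_words_iff length_Suc_conv)

text \<open>The number of interior points in the decomposition: both junctions involve a column of height 1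
  and vanish, while the raised part gains one point per pair of consecutive columns.\<close>

lemma overlap_join_words:
  assumes u: "u \<in> motzkin_words a" and v: "v \<in> motzkin_words' b"
  shows "overlap (join_words (u, v)) = overlap u + (a - 1) + overlap v"
proof -
  have ne: "u \<noteq> []" "length u = a" "hd u = 1" using u by (auto simp: mem_motzkin_words_iff)
  have ov: "overlap (map Suc u) = overlap u + (a - 1)"
    using overlap_map_Suc[of u] motzkin_word_pos[OF u] ne by auto
  have "overlap (join_words (u, v)) = overlap (map Suc u @ v)"
    using ne by (cases u) (auto simp: join_words_def)
  also have "\<dots> = overlap (map Suc u) + overlap v"
    using ne v by (cases "v = []")
      (auto simp: overlap_append motzkin_words'_def mem_motzkin_words_iff split: if_splits)
  finally show ?thesis using ov by simp
qed

section \<open>Generating functions\<close>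

definition word_fps :: "real fps" where
  "word_fps = Abs_fps (\<lambda>n. real (card (motzkin_words n)))"

definition inter_fps :: "real fps" where
  "inter_fps = Abs_fps (\<lambda>n. \<Sum>w\<in>motzkin_words n. real (inter_count w))"

definition trinomial_fps :: "real fps" where
  "trinomial_fps = Abs_fps (\<lambda>n. real_of_int (central_trinomial n))"

lemma card_motzkin_words'_conv:
  "real (card (motzkin_words' n)) = fps_nth (1 + word_fps) n"
  by (simp add: motzkin_words'_def word_fps_def motzkin_words_0)

lemma sum_overlap_motzkin_words'_conv:
  "(\<Sum>v\<in>motzkin_words' n. real (overlap v)) = fps_nth inter_fps n"
  by (simp add: motzkin_words'_def inter_fps_def inter_count_eq_overlap motzkin_words_0)

lemma word_fps_eq: "word_fps = fps_X + fps_X * word_fps * (1 + word_fps)"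
proof (rule fps_ext)
  fix n
  consider "n = 0" | "n = 1" | k where "n = Suc k" "k > 0" by (cases n) auto
  thus "fps_nth word_fps n = fps_nth (fps_X + fps_X * word_fps * (1 + word_fps)) n"
  proof cases
    case 3
    have "fps_nth word_fps n = (\<Sum>w\<in>motzkin_words (Suc k). 1)"
      using 3 by (simp add: word_fps_def)
    also have "\<dots> = (\<Sum>a\<le>k. real (card (motzkin_words a)) * real (card (motzkin_words' (k - a))))"
      by (subst sum_motzkin_words_Suc[OF 3(2)]) simp
    also have "\<dots> = fps_nth (word_fps * (1 + word_fps)) k"
      unfolding fps_mult_nth card_motzkin_words'_conv by (simp add: word_fps_def atLeast0AtMost)
    finally show ?thesis using 3 by (simp add: mult.assoc)
  qed (simp_all add: word_fps_def motzkin_words_0 motzkin_words_1 mult.assoc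
        del: One_nat_def)
qed

text \<open>The coefficient of \<open>fps_X * fps_deriv word_fps - word_fps\<close> at \<open>a\<close> is \<open>a - 1\<close> times the number of
  words of length \<open>a\<close>: it accounts for the points gained by raising the first part.\<close>

lemma inter_fps_eq:
  "inter_fps = fps_X * ((inter_fps + (fps_X * fps_deriv word_fps - word_fps)) * (1 + word_fps)
                        + word_fps * inter_fps)"
proof (rule fps_ext)
  fix n
  let ?R = "(inter_fps + (fps_X * fps_deriv word_fps - word_fps)) * (1 + word_fps) + word_fps * inter_fps"
  consider "n = 0" | "n = 1" | k where "n = Suc k" "k > 0" by (cases n) auto
  thus "fps_nth inter_fps n = fps_nth (fps_X * ?R) n"
  proof cases
    case 3
    let ?c = "\<lambda>a. real (card (motzkin_words a))" and ?c' = "\<lambda>a. real (card (motzkin_words' a))"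
    have weight: "(real a - 1) * ?c a = fps_nth (fps_X * fps_deriv word_fps - word_fps) a" for a
      by (cases a) (auto simp: word_fps_def algebra_simps)
    have "fps_nth inter_fps n = (\<Sum>w\<in>motzkin_words (Suc k). real (overlap w))"
      using 3 by (simp add: inter_fps_def inter_count_eq_overlap)
    also have "\<dots> = (\<Sum>a\<le>k. \<Sum>u\<in>motzkin_words a. \<Sum>v\<in>motzkin_words' (k - a).
                        real (overlap u) + (real a - 1) + real (overlap v))"
      unfolding sum_motzkin_words_Suc[OF 3(2)]
    proof (intro sum.cong refl)
      fix a u v assume "u \<in> motzkin_words a" "v \<in> motzkin_words' (k - a)"
      moreover from this have "1 \<le> a" by (auto simp: motzkin_words_def)
      ultimately show "real (overlap (join_words (u, v))) = real (overlap u) + (real a - 1) + real (overlap v)"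
        by (simp add: overlap_join_words of_nat_diff)
    qed
    also have "\<dots> = (\<Sum>a\<le>k. ((\<Sum>u\<in>motzkin_words a. real (overlap u)) + (real a - 1) * ?c a) * ?c' (k - a)
                             + ?c a * (\<Sum>v\<in>motzkin_words' (k - a). real (overlap v)))"
      by (intro sum.cong refl)
         (simp add: sum.distrib distrib_right mult.commute flip: sum_distrib_left sum_distrib_right)
    also have "\<dots> = fps_nth ?R k"
      unfolding fps_add_nth[of "_ * _"] fps_mult_nth card_motzkin_words'_conv
        sum_overlap_motzkin_words'_conv weight sum.distrib
      by (simp add: word_fps_def inter_fps_def inter_count_eq_overlap atLeast0AtMost)
    finally show ?thesis using 3 by simp
  qed (simp_all add: inter_fps_def word_fps_def motzkin_words_0 motzkin_words_1 inter_count_eq_overlap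
        del: One_nat_def)
qed

text \<open>Completing the square in the quadratic equation for \<open>word_fps\<close> shows that the squares agree; the
  constant coefficient 1 selects the sign.\<close>

lemma fps_radical_conv_word_fps:
  "fps_radical root 2 (1 - 2 * fps_X - 3 * fps_X ^ 2) = 1 - fps_X - 2 * fps_X * word_fps" (is "?S = ?R")
proof -
  have "?R ^ 2 = 1 - 2 * fps_X - 3 * fps_X ^ 2"
    using word_fps_eq by algebra
  hence "?S ^ 2 = ?R ^ 2" by (simp only: fps_sqrt_power2)
  hence "?S = ?R \<or> ?S = - ?R" by (simp only: power2_eq_iff)
  moreover have "fps_nth ?S 0 \<noteq> fps_nth (- ?R) 0" by simp
  ultimately show ?thesis by metis
qed

lemma word_fps_conv_motzkin_fps: "word_fps = fps_X * motzkin_fps"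
proof -
  have "(2 * fps_X) * word_fps = (2 * fps_X) * (fps_X * motzkin_fps)"
    using motzkin_fps_mult fps_radical_conv_word_fps by algebra
  thus ?thesis by simp
qed

lemma coeff_Suc_trinomial_mult:
  "coeff ([:1, 1, 1:] * q :: int poly) (Suc n) =
     coeff q (Suc n) + coeff q n + (if n = 0 then 0 else coeff q (n - 1))"
  by (cases n) auto

lemma pderiv_trinomial_power:
  "pderiv ([:1, 1, 1:] ^ Suc n) = smult (of_nat (Suc n)) ([:1, 2:] * [:1, 1, 1:] ^ n :: int poly)"
proof -
  have "pderiv [:1, 1, 1 :: int:] = [:1, 2:]" by (simp add: pderiv_pCons)
  thus ?thesis by (simp only: pderiv_power_Suc mult_smult_left mult_smult_right mult.commute)
qed

text \<open>The two neighbours of the central coefficient of \<open>p\<^sup>N\<close>, where \<open>p = 1 + x + x\<^sup>2\<close> and \<open>N = n + 1\<close>,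
  are equal. This is read off from the coefficient of \<open>x\<^sup>N\<close> in \<open>p (p\<^sup>N)' = N (1 + 2 x) p\<^sup>N\<close>: the
  central coefficient itself occurs on both sides with the factor \<open>N\<close> and cancels.\<close>

lemma coeff_trinomial_power_symmetric:
  "coeff ([:1, 1, 1:] ^ Suc n :: int poly) (Suc (Suc n)) = coeff ([:1, 1, 1:] ^ Suc n) n"
proof -
  define p :: "int poly" where "p = [:1, 1, 1:]"
  define c where "c = coeff (p ^ Suc n)"
  have "p * pderiv (p ^ Suc n) = smult (of_nat (Suc n)) ([:1, 2:] * p ^ Suc n)"
    unfolding pderiv_trinomial_power[folded p_def]
    by (simp only: mult_smult_right power_Suc mult.left_commute)
  hence "coeff (p * pderiv (p ^ Suc n)) (Suc n) = coeff (smult (of_nat (Suc n)) ([:1, 2:] * p ^ Suc n)) (Suc n)"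
    by (rule arg_cong)
  also have "coeff (p * pderiv (p ^ Suc n)) (Suc n) =
      int (n + 2) * c (n + 2) + int (n + 1) * c (n + 1) + int n * c n"
    unfolding p_def coeff_Suc_trinomial_mult by (simp add: coeff_pderiv c_def p_def)
  also have "coeff (smult (of_nat (Suc n)) ([:1, 2:] * p ^ Suc n)) (Suc n) =
      int (n + 1) * (c (n + 1) + 2 * c n)"
    by (simp add: c_def del: power_Suc)
  finally have "int (n + 2) * (c (n + 2) - c n) = 0" by (simp add: algebra_simps)
  thus ?thesis by (simp add: c_def p_def)
qed

lemma central_trinomial_Suc:
  "central_trinomial (Suc n) = central_trinomial n + 2 * coeff ([:1, 1, 1:] ^ n) (Suc n)"
proof -
  let ?p = "[:1, 1, 1:] :: int poly"
  have "int (Suc n) * coeff (?p ^ Suc n) (Suc n) = coeff (pderiv (?p ^ Suc n)) n"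
    by (simp only: coeff_pderiv)
  also have "\<dots> = int (Suc n) * (coeff (?p ^ n) n + 2 * coeff (?p ^ n) (Suc n))"
    unfolding pderiv_trinomial_power
    by (cases n) (simp_all add: coeff_trinomial_power_symmetric del: power_Suc of_nat_Suc)
  finally show ?thesis by (simp add: central_trinomial_def del: power_Suc of_nat_Suc)
qed

lemma coeff_next_to_central_trinomial_Suc:
  "int (n + 2) * coeff ([:1, 1, 1:] ^ Suc n) (Suc (Suc n)) =
     int (n + 1) * (coeff ([:1, 1, 1:] ^ n) (Suc n) + 2 * central_trinomial n)"
proof -
  let ?p = "[:1, 1, 1:] :: int poly"
  have "int (n + 2) * coeff (?p ^ Suc n) (Suc (Suc n)) = coeff (pderiv (?p ^ Suc n)) (Suc n)"
    by (simp add: coeff_pderiv del: power_Suc)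
  thus ?thesis
    unfolding pderiv_trinomial_power by (simp add: central_trinomial_def del: power_Suc)
qed

text \<open>Comparing coefficients in \<open>(p\<^sup>N)' = N (1 + 2 x) p\<^sup>N\<^sup>-\<^sup>1\<close> gives two first-order recurrences that
  link the central coefficient with the next one; eliminating the latter leaves this one.\<close>

lemma central_trinomial_recurrence:
  "int (n + 2) * central_trinomial (n + 2) =
     int (2 * n + 3) * central_trinomial (n + 1) + 3 * int (n + 1) * central_trinomial n"
proof -
  define u where "u = (\<lambda>n. coeff ([:1, 1, 1:] ^ n :: int poly) (Suc n))"
  have T: "central_trinomial (Suc k) = central_trinomial k + 2 * u k" for k
    by (simp only: central_trinomial_Suc u_def)
  have "int (n + 2) * u (Suc n) = int (n + 1) * (u n + 2 * central_trinomial n)"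
    unfolding u_def by (rule coeff_next_to_central_trinomial_Suc)
  thus ?thesis using T[of n] T[of "Suc n"] by (simp add: algebra_simps)
qed

lemma trinomial_fps_ode:
  "(1 - 2 * fps_X - 3 * fps_X ^ 2) * fps_deriv trinomial_fps = (1 + 3 * fps_X) * trinomial_fps"
proof (rule fps_ext)
  fix n
  have T01: "central_trinomial 0 = 1" "central_trinomial (Suc 0) = 1"
    by (simp_all add: central_trinomial_def)
  let ?d = "fps_deriv trinomial_fps"
  have lhs: "(1 - 2 * fps_X - 3 * fps_X ^ 2) * ?d =
      ?d - fps_const 2 * (fps_X * ?d) - fps_const 3 * (fps_X * (fps_X * ?d))"
    by (simp add: numeral_fps_const algebra_simps power2_eq_square)
  have rhs: "(1 + 3 * fps_X) * trinomial_fps = trinomial_fps + fps_const 3 * (fps_X * trinomial_fps)"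
    by (simp add: numeral_fps_const algebra_simps)
  consider "n = 0" | k where "n = Suc k" by (cases n) auto
  thus "fps_nth ((1 - 2 * fps_X - 3 * fps_X ^ 2) * ?d) n = fps_nth ((1 + 3 * fps_X) * trinomial_fps) n"
  proof cases
    case 1
    thus ?thesis unfolding lhs rhs by (simp add: trinomial_fps_def T01)
  next
    case 2
    have "real_of_int (int (k + 2) * central_trinomial (k + 2)) =
        real_of_int (int (2 * k + 3) * central_trinomial (k + 1) + 3 * int (k + 1) * central_trinomial k)"
      by (simp only: central_trinomial_recurrence)
    thus ?thesis unfolding lhs rhs using 2
      by (cases k) (simp_all add: trinomial_fps_def algebra_simps)
  qed
qed

text \<open>If \<open>S\<^sup>2 = 1 - 2 x - 3 x\<^sup>2\<close> then \<open>S S' = - 1 - 3 x\<close>, so the differential equation for \<open>T\<close> says that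
  \<open>S (T S)' = S\<^sup>2 T' + T S S' = 0\<close>. Thus \<open>T S\<close> is constant.\<close>

lemma trinomial_fps_mult_radical:
  "trinomial_fps * fps_radical root 2 (1 - 2 * fps_X - 3 * fps_X ^ 2) = 1" (is "?T * ?S = 1")
proof -
  have sq: "?S ^ 2 = 1 - 2 * fps_X - 3 * fps_X ^ 2" by (rule fps_sqrt_power2)
  have "fps_deriv (?S ^ 2) = fps_deriv (1 - 2 * fps_X - 3 * fps_X ^ 2)"
    by (simp only: sq)
  hence "2 * (?S * fps_deriv ?S) = 2 * (- 1 - 3 * fps_X)"
    by (simp add: power2_eq_square algebra_simps)
  hence dS: "?S * fps_deriv ?S = - 1 - 3 * fps_X"
    by (subst (asm) mult_left_cancel) simp_all
  have "?S * fps_deriv (?T * ?S) = ?S ^ 2 * fps_deriv ?T + ?T * (?S * fps_deriv ?S)"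
    by (simp add: algebra_simps power2_eq_square)
  also have "\<dots> = 0" unfolding sq dS trinomial_fps_ode by (simp add: algebra_simps)
  finally have "?S * fps_deriv (?T * ?S) = 0" .
  moreover have "fps_nth ?S 0 = 1" by simp
  hence "?S \<noteq> 0" by force
  ultimately have "fps_deriv (?T * ?S) = 0" by simp
  hence "?T * ?S = fps_const (fps_nth (?T * ?S) 0)" by (rule iffD1[OF fps_deriv_eq_0_iff])
  thus ?thesis by (simp add: trinomial_fps_def central_trinomial_def)
qed

text \<open>The constant term 2 makes the identity hold at \<open>n = 0\<close>, where the other series contribute
  \<open>1 - 3\<close> although there are no Motzkin words of length 0. The proof multiplies by \<open>S\<^sup>2\<close>, which turns
  every series into a polynomial in \<open>x\<close> and \<open>word_fps\<close>.\<close>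

lemma inter_fps_closed_form:
  "2 * inter_fps = 2 + Abs_fps (\<lambda>n. 3 ^ n) - 3 * trinomial_fps - 4 * fps_X * trinomial_fps + 4 * word_fps"
proof -
  define S :: "real fps" where "S = 1 - fps_X - 2 * fps_X * word_fps"
  define G :: "real fps" where "G = Abs_fps (\<lambda>n. 3 ^ n)"
  note M = word_fps_eq
  have dM: "fps_deriv word_fps * S = 1 + word_fps * (1 + word_fps)"
  proof -
    have "fps_deriv word_fps = fps_deriv (fps_X + fps_X * word_fps * (1 + word_fps))"
      using M by simp
    also have "\<dots> = 1 + word_fps * (1 + word_fps) + fps_X * fps_deriv word_fps * (1 + 2 * word_fps)"
      by (simp add: algebra_simps)
    finally show ?thesis unfolding S_def by algebra
  qed
  have IS: "inter_fps * S = fps_X * (1 + word_fps) * (fps_X * fps_deriv word_fps - word_fps)"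
    using inter_fps_eq unfolding S_def by algebra
  have "inter_fps * S ^ 2 = fps_X * (1 + word_fps) * (fps_X * (fps_deriv word_fps * S) - word_fps * S)"
    using IS by algebra
  also have "\<dots> = fps_X * (1 + word_fps) * word_fps * (1 - S)"
    unfolding dM using M by algebra
  finally have IS2: "inter_fps * S ^ 2 = fps_X * (1 + word_fps) * word_fps * (1 - S)" .
  have S: "fps_radical root 2 (1 - 2 * fps_X - 3 * fps_X ^ 2) = S"
    unfolding S_def by (rule fps_radical_conv_word_fps)
  have sq: "S ^ 2 = (1 - 3 * fps_X) * (1 + fps_X)"
    using fps_sqrt_power2 unfolding S by algebra
  have TS: "trinomial_fps * S = 1" using trinomial_fps_mult_radical unfolding S .
  have G: "G * (1 - 3 * fps_X) = 1"
  proof (rule fps_ext)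
    fix n show "fps_nth (G * (1 - 3 * fps_X)) n = fps_nth 1 n"
      by (cases n) (auto simp: G_def algebra_simps numeral_fps_const)
  qed
  have GS: "G * S ^ 2 = 1 + fps_X" unfolding sq using G by algebra
  have TS2: "trinomial_fps * S ^ 2 = S" using TS by algebra
  \<comment> \<open>After substituting for \<open>S\<close>, both sides reduce to \<open>4 M - 4 x - 2 x\<^sup>2 - 2 x M - 4 x\<^sup>2 M\<close>
    modulo the quadratic equation for \<open>M = word_fps\<close>.\<close>
  have "2 * (fps_X * (1 + word_fps) * word_fps * (1 - S)) =
        2 * S ^ 2 + (1 + fps_X) - 3 * S - 4 * fps_X * S + 4 * word_fps * S ^ 2"
    unfolding sq unfolding S_def using M by algebra
  hence "(2 * inter_fps) * S ^ 2 = (2 + G - 3 * trinomial_fps - 4 * fps_X * trinomial_fps + 4 * word_fps) * S ^ 2"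
    using IS2 GS TS2 by algebra
  moreover have "S ^ 2 \<noteq> 0"
    using TS by auto
  ultimately show ?thesis unfolding G_def by simp
qed

theorem corollary6p4:
  fixes n :: nat
  assumes "n \<ge> 1"
  shows "(\<Sum>w\<in>motzkin_words n. real (inter_count w)) =
           1 / 2 * (3 ^ n - 3 * real_of_int (central_trinomial n))
             - 2 * real_of_int (central_trinomial (n - 1)) + 2 * motzkin_number (n - 1)"
proof -
  obtain m where n: "n = Suc m" using assms by (cases n) auto
  \<comment> \<open>The numerals are written as \<open>fps_const\<close> so that coefficients can be extracted by rewriting.\<close>
  have "2 * inter_fps = 2 + Abs_fps (\<lambda>n. 3 ^ n) - fps_const 3 * trinomial_fps
          - fps_const 4 * (fps_X * trinomial_fps) + fps_const 4 * (fps_X * motzkin_fps)"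
    using inter_fps_closed_form
    by (simp add: word_fps_conv_motzkin_fps numeral_fps_const mult.assoc)
  hence "fps_nth (fps_const 2 * inter_fps) n = fps_nth (fps_const 2 + Abs_fps (\<lambda>n. 3 ^ n) - fps_const 3 * trinomial_fps
          - fps_const 4 * (fps_X * trinomial_fps) + fps_const 4 * (fps_X * motzkin_fps)) n"
    by (simp add: numeral_fps_const)
  hence "2 * (\<Sum>w\<in>motzkin_words n. real (inter_count w)) =
      3 ^ n - 3 * real_of_int (central_trinomial n) - 4 * real_of_int (central_trinomial m) + 4 * motzkin_number m"
    by (simp add: n inter_fps_def trinomial_fps_def motzkin_number_def)
  thus ?thesis by (simp add: n field_simps)
qed

end
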